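(* There is an absolute constant $c>0$ such that the following holds. Let $n$ and $k$ be positive integers and let $\Gamma\subset\mathbb{R}^2$ be a conical grid of order $n$. If $\mathcal{L}$ is a finite multiset of lines in $\mathbb{R}^2$ such that every point of $\Gamma$ lies on at least $k$ lines of $\mathcal{L}$ (counted with multiplicity), then $$|\mathcal{L}|\ \ge\ nk\left(1-\frac{1}{e}-\frac{c}{n}\right).$$ That is, the minimum number of lines required to cover every point of $\Gamma$ at least $k$ times is at least $nk\left(1-\frac1e-O(\frac1n)\right)$.
   Context: A conical grid of order $n$ on a set $\{a_0,a_1,\dots,a_{n-1}\}$ of reals with $a_0<a_1<\cdots<a_{n-1}$ is a subset $\mathcal{C}\subset\mathbb{R}^2$ of size $\frac{n(n+1)}{2}$ such that for each $i\in\{0,\dots,n-1\}$ the horizontal line $y=a_i$ contains exactly $n-i$ points of $\mathcal{C}$. Lines may be repeated in a covering; the number of lines is counted with multiplicity. *)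

theory Defs
  imports "HOL-Analysis.Analysis" "HOL-Library.Multiset"
begin

definition conical_grid_on :: "nat \<Rightarrow> (nat \<Rightarrow> real) \<Rightarrow> (real \<times> real) set \<Rightarrow> bool" where
  "conical_grid_on n a C \<longleftrightarrow>
     strict_mono_on {..<n} a \<and>
     finite C \<and> card C = n * (n + 1) div 2 \<and>
     (\<forall>i<n. card {p \<in> C. snd p = a i} = n - i)"

definition conical_grid :: "nat \<Rightarrow> (real \<times> real) set \<Rightarrow> bool" where
  "conical_grid n C \<longleftrightarrow> (\<exists>a. conical_grid_on n a C)"

definition is_line :: "(real \<times> real) set \<Rightarrow> bool" where
  "is_line L \<longleftrightarrow> affine L \<and> aff_dim L = 1"

definition covers_at_least ::
    "(real \<times> real) set multiset \<Rightarrow> nat \<Rightarrow> (real \<times> real) set \<Rightarrow> bool" where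
  "covers_at_least \<L> k S \<longleftrightarrow> (\<forall>p\<in>S. size {#L \<in># \<L>. p \<in> L#} \<ge> k)"

end

theory Submission
  imports Defs
begin

text \<open>
  Linear programming duality: give each point of the row \<open>y = a\<^sub>i\<close> the weight \<open>1 / (n - i)\<close> for
  \<open>i < m = \<lfloor>n (1 - 1/e)\<rfloor>\<close>, and weight zero in the higher rows. A horizontal line carries total
  weight at most 1, and any other line meets each row at most once, so it carries at most
  \<open>\<Sum>i<m. 1 / (n - i) \<le> ln (n / (n - m)) \<le> 1\<close>. Since each of the first \<open>m\<close> rows has total
  weight 1, a \<open>k\<close>-fold cover consists of at least \<open>k m\<close> lines.
\<close>

text \<open>Two distinct points of \<open>L\<close> span an affine hull of dimension 1 inside
  \<open>L\<close>, hence all of \<open>L\<close>; at equal heights that hull stays at this height.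
  Contrapositively, a non-horizontal line meets each row at most once.\<close>

lemma line_horizontal:
  assumes "is_line L" "p \<in> L" "q \<in> L" "p \<noteq> q" "snd p = snd q"
  shows "L \<subseteq> {z. snd z = snd p}"
proof -
  have "affine hull {p, q} = L"
  proof (rule affine_dim_equal)
    show "affine hull {p, q} \<subseteq> L"
      using assms by (intro hull_minimal) (auto simp: is_line_def)
    show "aff_dim (affine hull {p, q}) = aff_dim L"
      using assms by (simp add: is_line_def aff_dim_2)
  qed (use assms in \<open>auto simp: is_line_def\<close>)
  moreover have "affine {z :: real \<times> real. snd z = snd p}"
    unfolding affine_def by (auto simp flip: distrib_right)
  hence "affine hull {p, q} \<subseteq> {z. snd z = snd p}"
    using assms by (intro hull_minimal) auto
  ultimately show ?thesis by simp
qed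

text \<open>Telescoping: each term satisfies 1/x \<le> ln x - ln (x - 1), which is ln u \<le> u - 1
  at u = (x - 1)/x. The hypothesis \<open>m < n\<close> keeps x - 1 positive.\<close>

lemma harmonic_segment_le_ln:
  assumes "m < n"
  shows "(\<Sum>i<m. 1 / real (n - i)) \<le> ln (real n) - ln (real (n - m))"
  using assms
proof (induction m)
  case 0
  then show ?case by simp
next
  case (Suc m)
  define x where "x = real (n - m)"
  have x: "x > 1" "real (n - Suc m) = x - 1"
    using Suc.prems by (auto simp: x_def of_nat_diff)
  have "ln ((x - 1) / x) \<le> (x - 1) / x - 1"
    using x by (intro ln_le_minus_one) auto
  moreover have "(x - 1) / x - 1 = - (1 / x)"
    using x by (simp add: field_simps)
  ultimately have "1 / x \<le> ln x - ln (x - 1)"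
    using x by (simp add: ln_div)
  thus ?case
    using Suc x by (simp add: x_def del: of_nat_diff)
qed

text \<open>Feasibility of the dual weights. For a horizontal line, injectivity of \<open>a\<close>
  leaves at most one nonzero summand, and row \<open>j\<close> has only \<open>n - j\<close> points;
  for any other line each numerator is at most 1, so \<open>harm\<close> applies.\<close>

lemma line_weight_le_one:
  fixes a :: "nat \<Rightarrow> real" and C :: "(real \<times> real) set"
  assumes grid: "conical_grid_on n a C" and L: "is_line L"
    and "m \<le> n" and harm: "(\<Sum>i<m. 1 / real (n - i)) \<le> 1"
  shows "(\<Sum>i<m. real (card {p \<in> C. snd p = a i \<and> p \<in> L}) / real (n - i)) \<le> 1"
proof (cases "\<exists>y. L \<subseteq> {z. snd z = y}")
  case True
  then obtain y where y: "L \<subseteq> {z. snd z = y}" by blast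
  have inj: "inj_on a {..<n}"
    using grid by (simp add: conical_grid_on_def strict_mono_on_imp_inj_on)
  have fin: "finite C" using grid by (simp add: conical_grid_on_def)
  show ?thesis
  proof (cases "\<exists>j<m. a j = y")
    case True
    then obtain j where j: "j < m" "a j = y" by blast
    have "(\<Sum>i<m. real (card {p \<in> C. snd p = a i \<and> p \<in> L}) / real (n - i))
        = (\<Sum>i\<in>{j}. real (card {p \<in> C. snd p = a i \<and> p \<in> L}) / real (n - i))"
    proof (rule sum.mono_neutral_right)
      show "\<forall>i\<in>{..<m} - {j}. real (card {p \<in> C. snd p = a i \<and> p \<in> L}) / real (n - i) = 0"
      proof
        fix i assume i: "i \<in> {..<m} - {j}"
        hence "a i \<noteq> y"
          using inj j \<open>m \<le> n\<close> by (auto simp: inj_on_def)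
        hence "{p \<in> C. snd p = a i \<and> p \<in> L} = {}" using y by auto
        thus "real (card {p \<in> C. snd p = a i \<and> p \<in> L}) / real (n - i) = 0"
          by (simp only: card.empty) simp
      qed
    qed (use j in auto)
    also have "card {p \<in> C. snd p = a j \<and> p \<in> L} \<le> card {p \<in> C. snd p = a j}"
      using fin by (intro card_mono) auto
    hence "real (card {p \<in> C. snd p = a j \<and> p \<in> L}) \<le> real (n - j)"
      using grid j(1) \<open>m \<le> n\<close> by (simp add: conical_grid_on_def del: of_nat_diff)
    hence "(\<Sum>i\<in>{j}. real (card {p \<in> C. snd p = a i \<and> p \<in> L}) / real (n - i)) \<le> 1"
      using j(1) \<open>m \<le> n\<close> by (simp add: divide_le_eq)
    finally show ?thesis .
  next
    case False
    have "(\<Sum>i<m. real (card {p \<in> C. snd p = a i \<and> p \<in> L}) / real (n - i)) = 0"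
    proof (rule sum.neutral, rule ballI)
      fix i assume "i \<in> {..<m}"
      hence "a i \<noteq> y" using False by auto
      hence "{p \<in> C. snd p = a i \<and> p \<in> L} = {}" using y by auto
      thus "real (card {p \<in> C. snd p = a i \<and> p \<in> L}) / real (n - i) = 0"
        by (simp only: card.empty) simp
    qed
    thus ?thesis by simp
  qed
next
  case False
  \<comment> \<open>Two distinct common points of \<open>L\<close> and a row would make
    \<open>L\<close> horizontal.\<close>
  have "card {p \<in> C. snd p = a i \<and> p \<in> L} \<le> Suc 0" for i
  proof -
    have "p = q" if "p \<in> L" "q \<in> L" "snd p = a i" "snd q = a i" for p q
      using line_horizontal[OF L that(1,2)] that False by fastforce
    moreover have "finite {p \<in> C. snd p = a i \<and> p \<in> L}"
      using grid by (simp add: conical_grid_on_def)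
    ultimately show ?thesis by (subst card_le_Suc0_iff_eq) blast+
  qed
  hence "(\<Sum>i<m. real (card {p \<in> C. snd p = a i \<and> p \<in> L}) / real (n - i))
      \<le> (\<Sum>i<m. 1 / real (n - i))"
    by (intro sum_mono divide_right_mono) auto
  with harm show ?thesis by linarith
qed

text \<open>Double counting of incidences between points of \<open>R\<close> and lines of
  \<open>M\<close>, with repeated lines counted by multiplicity on both sides.\<close>

lemma sum_size_filter_eq_sum_mset_card:
  assumes "finite R"
  shows "(\<Sum>p\<in>R. size {#L \<in># M. p \<in> L#}) = (\<Sum>L\<in>#M. card {p \<in> R. p \<in> L})"
proof (induction M)
  case empty
  then show ?case by simp
next
  case (add L M)
  have "(\<Sum>p\<in>R. size {#X \<in># add_mset L M. p \<in> X#})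
      = (\<Sum>p\<in>R. (if p \<in> L then 1 else 0) + size {#X \<in># M. p \<in> X#})"
    by (intro sum.cong) auto
  also have "\<dots> = card {p \<in> R. p \<in> L} + (\<Sum>p\<in>R. size {#X \<in># M. p \<in> X#})"
    using assms by (simp add: sum.distrib sum.If_cases Int_def)
  finally show ?case using add by simp
qed

lemma sum_sum_mset_swap:
  fixes f :: "'a \<Rightarrow> 'b \<Rightarrow> 'c :: comm_monoid_add"
  shows "(\<Sum>i\<in>A. \<Sum>x\<in>#M. f i x) = (\<Sum>x\<in>#M. \<Sum>i\<in>A. f i x)"
  by (induction M) (auto simp: sum.distrib)

lemma sum_mset_le_size:
  fixes f :: "'a \<Rightarrow> real"
  assumes "\<And>x. x \<in># M \<Longrightarrow> f x \<le> 1"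
  shows "(\<Sum>x\<in>#M. f x) \<le> real (size M)"
  using sum_mset_mono[of M f "\<lambda>_. 1"] assms by simp

text \<open>Weak duality: the lines give each of the first \<open>m\<close> rows total weight at
  least \<open>k\<close>, while each line contributes at most 1 over all these rows. Exchanging the
  two sums compares the bounds.\<close>

lemma cover_size_ge:
  fixes \<L> :: "(real \<times> real) set multiset"
  assumes grid: "conical_grid_on n a C" and lines: "\<forall>L\<in>#\<L>. is_line L"
    and cover: "covers_at_least \<L> k C"
    and "m \<le> n" and harm: "(\<Sum>i<m. 1 / real (n - i)) \<le> 1"
  shows "real k * real m \<le> real (size \<L>)"
proof -
  define w where "w = (\<lambda>i L. real (card {p \<in> C. snd p = a i \<and> p \<in> L}) / real (n - i))"
  have row: "real k \<le> (\<Sum>L\<in>#\<L>. w i L)" if "i < m" for i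
  proof -
    define R where "R = {p \<in> C. snd p = a i}"
    have R: "finite R" "card R = n - i"
      using grid that \<open>m \<le> n\<close> by (auto simp: R_def conical_grid_on_def)
    \<comment> \<open>Row \<open>i\<close> has \<open>n - i\<close> points, each on at least
      \<open>k\<close> lines; dividing the incidence count by \<open>n - i\<close> gives the weight
      bound.\<close>
    have "k * (n - i) \<le> (\<Sum>p\<in>R. size {#L \<in># \<L>. p \<in> L#})"
      using sum_bounded_below[of R k "\<lambda>p. size {#L \<in># \<L>. p \<in> L#}"] cover R
      by (simp add: R_def covers_at_least_def mult.commute)
    also have "\<dots> = (\<Sum>L\<in>#\<L>. card {p \<in> C. snd p = a i \<and> p \<in> L})"
      using R by (simp add: sum_size_filter_eq_sum_mset_card R_def conj_assoc)
    finally have "real k * real (n - i)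
        \<le> real (\<Sum>L\<in>#\<L>. card {p \<in> C. snd p = a i \<and> p \<in> L})"
      unfolding of_nat_mult[symmetric] of_nat_le_iff .
    also have "\<dots> = (\<Sum>L\<in>#\<L>. w i L) * real (n - i)"
      using that \<open>m \<le> n\<close>
      by (simp add: w_def sum_mset_distrib_right of_nat_sum_mset multiset.map_comp comp_def)
    finally show ?thesis using that \<open>m \<le> n\<close> by simp
  qed
  have "real k * real m = (\<Sum>i<m. real k)" by simp
  also have "\<dots> \<le> (\<Sum>i<m. \<Sum>L\<in>#\<L>. w i L)"
    using row by (intro sum_mono) auto
  also have "\<dots> = (\<Sum>L\<in>#\<L>. \<Sum>i<m. w i L)"
    by (rule sum_sum_mset_swap)
  also have "\<dots> \<le> real (size \<L>)"
    unfolding w_def using line_weight_le_one[OF grid _ \<open>m \<le> n\<close> harm] lines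
    by (intro sum_mset_le_size) auto
  finally show ?thesis .
qed

theorem theorem1p1:
  shows "\<exists>c::real. c > 0 \<and>
    (\<forall>(n::nat) (k::nat) (\<Gamma> :: (real \<times> real) set) (\<L> :: (real \<times> real) set multiset).
       n > 0 \<longrightarrow> k > 0 \<longrightarrow> conical_grid n \<Gamma> \<longrightarrow>
       (\<forall>L\<in>#\<L>. is_line L) \<longrightarrow> covers_at_least \<L> k \<Gamma> \<longrightarrow>
       real (size \<L>) \<ge> real n * real k * (1 - 1 / exp 1 - c / real n))"
\<comment> \<open>The constant 1 pays for rounding: the floor below costs at most one row, that is,
  at most \<open>k\<close> lines.\<close>
proof (intro exI[of _ 1] conjI allI impI)
  fix n k :: nat and \<Gamma> :: "(real \<times> real) set" and \<L> :: "(real \<times> real) set multiset"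
  assume n: "n > 0" and "k > 0" and "conical_grid n \<Gamma>"
    and lines: "\<forall>L\<in>#\<L>. is_line L" and cover: "covers_at_least \<L> k \<Gamma>"
  then obtain a where grid: "conical_grid_on n a \<Gamma>" by (auto simp: conical_grid_def)
  define t where "t = real n * (1 - 1 / exp 1)"
  \<comment> \<open>This is the largest \<open>m\<close> with n - m \<ge> n/e, the condition that
    bounds ln (n/(n - m)) by 1.\<close>
  define m where "m = nat \<lfloor>t\<rfloor>"
  have t: "0 \<le> t" "t < real n"
    using n by (auto simp: t_def)
  have m: "real m \<le> t" "t - 1 \<le> real m"
    using t unfolding m_def by linarith+
  have "m < n" using m t by linarith
  have "real n / exp 1 \<le> real (n - m)"
    using m \<open>m < n\<close> by (simp add: t_def of_nat_diff right_diff_distrib)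
  hence "ln (real n / exp 1) \<le> ln (real (n - m))"
    using n \<open>m < n\<close> by (subst ln_le_cancel_iff) auto
  hence "ln (real n) - ln (real (n - m)) \<le> 1"
    using n by (simp add: ln_div)
  with harmonic_segment_le_ln[OF \<open>m < n\<close>] have "(\<Sum>i<m. 1 / real (n - i)) \<le> 1"
    by linarith
  hence "real k * real m \<le> real (size \<L>)"
    using cover_size_ge[OF grid lines cover] \<open>m < n\<close> by simp
  moreover have "real k * (t - 1) \<le> real k * real m"
    using m by (intro mult_left_mono) auto
  moreover have "real n * real k * (1 - 1 / exp 1 - 1 / real n) = real k * (t - 1)"
    using n by (simp add: t_def field_simps)
  ultimately show "real (size \<L>) \<ge> real n * real k * (1 - 1 / exp 1 - 1 / real n)"
    by linarith
qed simp

end
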